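(* Let $X$ and $Y$ be i.i.d. log-concave random variables on $\mathbb{Z}$, and assume that their common probability mass function $f$ is monotone. Then $$\|f\ast f\|_\infty> e^{-1}\|f\|_\infty,$$ or equivalently $$H_\infty(X+Y)<H_\infty(X)+1.$$ Moreover, the inequality cannot be improved: the constant $e^{-1}$ cannot be replaced by any larger constant (valid for all such $f$).
   Context: An integer-valued random variable with probability mass function $f:\mathbb{Z}\to[0,1]$ is log-concave if $f(k+1)^2\ge f(k)f(k+2)$ for all $k\in\mathbb{Z}$ and the support of $f$ is a contiguous interval of $\mathbb{Z}$. The probability mass function is called monotone if it is non-increasing on its support or non-decreasing on its support. Here $(f\ast f)(k)=\sum_{i\in\mathbb{Z}}f(i)f(k-i)$, $\|f\|_\infty=\sup_{k\in\mathbb{Z}}f(k)$, and for an integer-valued random variable $X$ with probability mass function $f$, $H_\infty(X)=-\log\|f\|_\infty$ (natural logarithm). *)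

theory Defs
  imports "HOL-Probability.Probability"
begin

definition mass_fun :: "'a measure \<Rightarrow> ('a \<Rightarrow> int) \<Rightarrow> int \<Rightarrow> real" where
  "mass_fun M X k = measure M {\<omega> \<in> space M. X \<omega> = k}"

definition supp :: "(int \<Rightarrow> real) \<Rightarrow> int set" where
  "supp f = {k. f k \<noteq> 0}"

definition log_concave :: "(int \<Rightarrow> real) \<Rightarrow> bool" where
  "log_concave f \<longleftrightarrow>
     (\<forall>k. (f (k + 1))\<^sup>2 \<ge> f k * f (k + 2)) \<and>
     (\<forall>i\<in>supp f. \<forall>k\<in>supp f. {i..k} \<subseteq> supp f)"

definition monotone_mass :: "(int \<Rightarrow> real) \<Rightarrow> bool" where
  "monotone_mass f \<longleftrightarrow> antimono_on (supp f) f \<or> mono_on (supp f) f"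

definition conv :: "(int \<Rightarrow> real) \<Rightarrow> (int \<Rightarrow> real) \<Rightarrow> int \<Rightarrow> real" where
  "conv f g k = (\<Sum>\<^sub>\<infinity>i. f i * g (k - i))"

text \<open>Only applied to nonnegative bounded functions, so no absolute value is needed.\<close>

definition sup_norm :: "(int \<Rightarrow> real) \<Rightarrow> real" where
  "sup_norm f = (SUP k. f k)"

definition H_inf :: "'a measure \<Rightarrow> ('a \<Rightarrow> int) \<Rightarrow> real" where
  "H_inf M X = - ln (sup_norm (mass_fun M X))"

definition iid :: "'a measure \<Rightarrow> ('a \<Rightarrow> int) \<Rightarrow> ('a \<Rightarrow> int) \<Rightarrow> bool" where
  "iid M X Y \<longleftrightarrow>
     prob_space.indep_var M (count_space UNIV) X (count_space UNIV) Y \<and>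
     distr M (count_space UNIV) X = distr M (count_space UNIV) Y"

end

theory Submission
  imports Defs
begin

text \<open>
  After a reflection, \<open>f\<close> is non-increasing on \<open>{a, a + 1, \<dots>}\<close>; put \<open>c n = f (a + n)\<close>. Log-concavity
  gives \<open>c i * c (n - i) \<ge> c 0 * c n\<close>, so \<open>(f * f)(2a + n) \<ge> (n + 1) * c n * c 0\<close>, and it is enough
  to find \<open>n\<close> with \<open>(n + 1) * c n > 1/e\<close>. Take a local maximum \<open>n\<close> of \<open>(n + 1) * c n\<close>, which exists
  because the harmonic series diverges. There is a slope \<open>r\<close> between \<open>n/(n+1)\<close> and \<open>(n+1)/(n+2)\<close>
  for which \<open>c k \<le> c n * r^(k - n)\<close> for all \<open>k\<close>; summing the geometric series,
  \<open>1 \<le> c n / (r^n * (1 - r)) < e * (n + 1) * c n\<close>. Geometric distributions with parameter tending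
  to zero show that the constant is optimal.
\<close>

subsection \<open>Log-concave sequences\<close>

text \<open>Monotonicity of the ratios \<open>c (j + 1) / c j\<close>, cross-multiplied so that
  zeros cause no trouble. The induction multiplies by log-concavity at \<open>j\<close> and cancels
  \<open>c j * c (j + 1)\<close>, which \<open>no_gap\<close> makes positive unless
  \<open>c (j + 2) = 0\<close>. Internal zeros must be excluded: the sequence 1, 0, 0, 1, 0, ...
  satisfies \<open>lc\<close> but not the conclusion.\<close>

lemma log_concave_cross:
  fixes c :: "nat \<Rightarrow> real"
  assumes nonneg: "\<And>n. c n \<ge> 0"
    and lc: "\<And>n. c n * c (n + 2) \<le> (c (n + 1))\<^sup>2"
    and no_gap: "\<And>m n. m \<le> n \<Longrightarrow> c n \<noteq> 0 \<Longrightarrow> c m \<noteq> 0"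
    and "i \<le> j"
  shows "c i * c (j + 1) \<le> c (i + 1) * c j"
  using \<open>i \<le> j\<close>
proof (induction j rule: dec_induct)
  case base
  then show ?case by simp
next
  case (step j)
  show ?case
  proof (cases "c (j + 2) = 0")
    case True
    then show ?thesis using nonneg by simp
  next
    case False
    then have pos: "c j > 0" "c (j + 1) > 0"
      using no_gap[of j "j + 2"] no_gap[of "j + 1" "j + 2"] nonneg by (simp_all add: less_le)
    have "c i * c (j + 2) * (c j * c (j + 1)) = (c i * c (j + 1)) * (c j * c (j + 2))"
      by (simp add: algebra_simps)
    also have "\<dots> \<le> (c (i + 1) * c j) * (c (j + 1))\<^sup>2"
      using nonneg by (intro mult_mono[OF step.IH lc]) auto
    also have "\<dots> = (c (i + 1) * c (j + 1)) * (c j * c (j + 1))"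
      by (simp add: power2_eq_square algebra_simps)
    finally have "c i * c (j + 2) \<le> c (i + 1) * c (j + 1)"
      using pos by (simp add: mult_le_cancel_right)
    then show ?thesis by simp
  qed
qed

text \<open>Induction on \<open>i\<close>, multiplying by \<open>log_concave_cross\<close> at
  \<open>i\<close> and \<open>i + m\<close> and cancelling. With \<open>m = n - i\<close> this
  bounds every summand of the convolution at \<open>n\<close> below by the same number
  \<open>c 0 * c n\<close>.\<close>

lemma log_concave_split:
  fixes c :: "nat \<Rightarrow> real"
  assumes nonneg: "\<And>n. c n \<ge> 0"
    and lc: "\<And>n. c n * c (n + 2) \<le> (c (n + 1))\<^sup>2"
    and no_gap: "\<And>m n. m \<le> n \<Longrightarrow> c n \<noteq> 0 \<Longrightarrow> c m \<noteq> 0"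
  shows "c 0 * c (i + m) \<le> c i * c m"
proof (induction i)
  case 0
  then show ?case by simp
next
  case (Suc i)
  show ?case
  proof (cases "c (i + m + 1) = 0")
    case True
    then show ?thesis using nonneg by simp
  next
    case False
    then have pos: "c (i + m) > 0"
      using no_gap[of "i + m" "i + m + 1"] nonneg by (simp add: less_le)
    have posi: "c i > 0"
      using no_gap[of i "i + m + 1"] False nonneg by (simp add: less_le)
    have "c 0 * c (i + m + 1) * (c i * c (i + m)) = (c 0 * c (i + m)) * (c i * c (i + m + 1))"
      by (simp add: algebra_simps)
    also have "\<dots> \<le> (c i * c m) * (c (i + 1) * c (i + m))"
      using nonneg
      by (intro mult_mono[OF Suc log_concave_cross[OF nonneg lc no_gap]]) auto
    also have "\<dots> = (c (i + 1) * c m) * (c i * c (i + m))"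
      by (simp add: algebra_simps)
    finally have "c 0 * c (i + m + 1) \<le> c (i + 1) * c m"
      using pos posi by (simp add: mult_le_cancel_right)
    then show ?thesis by simp
  qed
qed

text \<open>On the support \<open>ln c\<close> is concave, and \<open>left\<close> and
  \<open>right\<close> make \<open>ln r\<close> the slope of a supporting line at \<open>n\<close>
  when \<open>r > 0\<close>. Multiplying by \<open>r ^ n\<close> avoids the exponent
  \<open>k - n\<close>, which is negative for \<open>k < n\<close>.\<close>

lemma log_concave_geometric_bound:
  fixes c :: "nat \<Rightarrow> real"
  assumes nonneg: "\<And>n. c n \<ge> 0"
    and lc: "\<And>n. c n * c (n + 2) \<le> (c (n + 1))\<^sup>2"
    and no_gap: "\<And>m n. m \<le> n \<Longrightarrow> c n \<noteq> 0 \<Longrightarrow> c m \<noteq> 0"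
    and pos: "c n > 0" and r: "r \<ge> 0"
    and right: "c (n + 1) \<le> r * c n"
    and left: "n > 0 \<Longrightarrow> r * c (n - 1) \<le> c n"
  shows "c k * r ^ n \<le> c n * r ^ k"
proof (cases "n \<le> k")
  case True
  have "c k \<le> c n * r ^ (k - n)"
    using True
  proof (induction k rule: dec_induct)
    case base
    then show ?case by simp
  next
    case (step j)
    have "c n * c (j + 1) \<le> c (n + 1) * c j"
      using log_concave_cross[of c n j, OF nonneg lc no_gap] step.hyps by auto
    also have "\<dots> \<le> (r * c n) * (c n * r ^ (j - n))"
      using step.IH right nonneg r by (intro mult_mono) auto
    finally have "c n * c (j + 1) \<le> c n * (c n * r ^ (j + 1 - n))"
      using step.hyps by (simp add: Suc_diff_le algebra_simps)
    then show ?case using pos by simp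
  qed
  then have "c k * r ^ n \<le> c n * r ^ (k - n) * r ^ n"
    using r by (intro mult_right_mono) auto
  also have "\<dots> = c n * r ^ k"
    using True by (simp add: mult.assoc flip: power_add)
  finally show ?thesis .
next
  case False
  then have "k \<le> n" by simp
  then have "c k * r ^ (n - k) \<le> c n"
  proof (induction k rule: inc_induct)
    case base
    then show ?case by simp
  next
    case (step j)
    \<comment> \<open>The ratio at \<open>j\<close> is at least the later ratio
      \<open>c n / c (n - 1)\<close>, which is at least \<open>r\<close> by
      \<open>left\<close>.\<close>
    have "c j * r \<le> c (j + 1)"
    proof -
      have n: "n - 1 + 1 = n" "j \<le> n - 1" "n > 0" using step.hyps by auto
      have pos': "c (n - 1) > 0" using no_gap[of "n - 1" n] pos nonneg by (simp add: less_le)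
      have "c j * r * c (n - 1) \<le> c j * c n"
        using left n nonneg[of j] by (simp add: mult.assoc mult_left_mono)
      also have "\<dots> \<le> c (j + 1) * c (n - 1)"
        using log_concave_cross[of c j "n - 1", OF nonneg lc no_gap] n by auto
      finally show ?thesis using pos' by simp
    qed
    then have "c j * r * r ^ (n - Suc j) \<le> c (j + 1) * r ^ (n - Suc j)"
      using r by (intro mult_right_mono) auto
    also have "\<dots> \<le> c n" using step.IH by simp
    finally show ?case using step.hyps by (simp add: Suc_diff_Suc mult.assoc flip: power_Suc)
  qed
  then have "c k * r ^ (n - k) * r ^ k \<le> c n * r ^ k"
    using r by (intro mult_right_mono) auto
  moreover have "r ^ (n - k) * r ^ k = r ^ n"
    using False by (simp flip: power_add)
  ultimately show ?thesis by (simp add: mult.assoc)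
qed

text \<open>Take the least \<open>n\<close> at which \<open>?d\<close> does not increase. Minimality
  gives the second inequality and, through \<open>chain\<close>, positivity of \<open>c n\<close>.
  If there were no such \<open>n\<close>, then \<open>c n\<close> would dominate
  \<open>c 0 / (n + 1)\<close>.\<close>

lemma summable_local_max:
  fixes c :: "nat \<Rightarrow> real"
  assumes "summable c" and c0: "c 0 > 0"
  obtains n where "real (n + 2) * c (n + 1) \<le> real (n + 1) * c n"
    and "n > 0 \<Longrightarrow> real n * c (n - 1) \<le> real (n + 1) * c n"
    and "c n > 0"
proof -
  let ?d = "\<lambda>n. real (n + 1) * c n"
  have chain: "c 0 \<le> ?d n" if "\<And>m. m < n \<Longrightarrow> ?d m < ?d (m + 1)" for n
    using that by (induction n) (force dest: less_imp_le order_trans)+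
  have "\<exists>n. ?d (n + 1) \<le> ?d n"
  proof (rule ccontr)
    assume "\<nexists>n. ?d (n + 1) \<le> ?d n"
    then have "c 0 \<le> ?d n" for n
      using chain[of n] by (auto simp: not_le)
    then have "norm (inverse (real (Suc n))) \<le> inverse (c 0) * c n" for n
      using c0 by (simp add: field_simps)
    then have "summable (\<lambda>n. inverse (real (Suc n)))"
      by (rule summable_comparison_test'[OF summable_mult[OF \<open>summable c\<close>]])
    then have "summable (\<lambda>n. inverse (real n))"
      by (subst (asm) summable_Suc_iff)
    then show False using not_summable_harmonic by blast
  qed
  define n where "n = (LEAST n. ?d (n + 1) \<le> ?d n)"
  have n: "?d (n + 1) \<le> ?d n"
    unfolding n_def by (rule LeastI_ex) fact
  have less: "?d m < ?d (m + 1)" if "m < n" for m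
    using not_less_Least[of m "\<lambda>n. ?d (n + 1) \<le> ?d n"] that by (simp add: n_def not_le)
  show ?thesis
  proof
    show "real (n + 2) * c (n + 1) \<le> real (n + 1) * c n"
      using n by (simp add: algebra_simps)
    show "real n * c (n - 1) \<le> real (n + 1) * c n" if "n > 0"
      using less[of "n - 1"] that by (simp add: of_nat_diff)
    show "c n > 0"
      using chain[of n] less c0 by (smt (verit) of_nat_0_le_iff mult_nonneg_nonpos)
  qed
qed

text \<open>With \<open>u = (n + 1) * (1 - r)\<close> the claim reads
  \<open>1 + ln u + n * ln r > 0\<close>. Replacing each \<open>ln x\<close> by its lower bound
  \<open>1 - 1 / x\<close> leaves a rational expression, nonnegative exactly because
  \<open>lo\<close> and \<open>hi\<close> confine \<open>u\<close> to the interval from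
  \<open>(n + 1) / (n + 2)\<close> to \<open>1\<close>. Strictness comes from \<open>ln r\<close>,
  whose factor \<open>n\<close> must therefore be positive.\<close>

lemma geometric_weight_gt:
  fixes r :: real
  assumes n: "n > 0" and lo: "real n / (real n + 1) \<le> r" and hi: "r \<le> (real n + 1) / (real n + 2)"
  shows "exp (- 1) < (real n + 1) * r ^ n * (1 - r)"
proof -
  define u where "u = (real n + 1) * (1 - r)"
  have "0 < real n / (real n + 1)" using n by simp
  then have r0: "0 < r" using lo by linarith
  have r1: "r < 1" using hi by (rule le_less_trans) simp
  have u: "0 < u" "u \<le> 1" "(real n + 1) \<le> (real n + 2) * u"
  proof -
    show "0 < u" using r1 by (simp add: u_def)
    show "u \<le> 1" using lo by (simp add: u_def field_simps)
    have "1 \<le> (real n + 2) * (1 - r)" using hi by (simp add: field_simps)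
    then have "(real n + 1) * 1 \<le> (real n + 1) * ((real n + 2) * (1 - r))"
      by (intro mult_left_mono) auto
    then show "real n + 1 \<le> (real n + 2) * u" by (simp add: u_def mult_ac)
  qed
  have r_eq: "(real n + 1) * r = real n + 1 - u" by (simp add: u_def algebra_simps)
  have "ln (1 / u) \<le> 1 / u - 1" using u by (intro ln_le_minus_one) auto
  then have ln_u: "1 - 1 / u \<le> ln u" using u by (simp add: ln_div)
  have "ln (1 / r) \<le> 1 / r - 1" using r0 by (intro ln_le_minus_one) auto
  moreover have "ln (1 / r) \<noteq> 1 / r - 1" using r0 r1 ln_eq_minus_one[of "1 / r"] by auto
  ultimately have ln_r: "1 - 1 / r < ln r" using r0 by (simp add: ln_div)
  \<comment> \<open>This quadratic in \<open>u\<close> vanishes at both ends of the interval allowed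
    for \<open>u\<close>; up to the factor \<open>n + 1\<close> it is the numerator of the rational
    lower bound.\<close>
  have "0 \<le> (1 - u) * ((real n + 2) * u - (real n + 1))" using u by simp
  also have "\<dots> = 2 * u * (real n + 1 - u) - (real n + 1 - u) - real n * u * u"
    by (simp add: algebra_simps power2_eq_square)
  also have "\<dots> = (real n + 1) * (2 * u * r - r - real n * u * (1 - r))"
  proof -
    have "real n * u * u = (real n + 1) * (real n * u * (1 - r))" by (simp add: u_def)
    then show ?thesis unfolding r_eq[symmetric] by (simp add: algebra_simps)
  qed
  finally have "0 \<le> 2 * u * r - r - real n * u * (1 - r)"
    by (simp add: zero_le_mult_iff)
  then have "0 \<le> (2 * u * r - r - real n * u * (1 - r)) / (u * r)"
    using u r0 by simp
  also have "\<dots> = 1 + (1 - 1 / u) + real n * (1 - 1 / r)"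
    using u r0 by (simp add: field_simps)
  also have "\<dots> < 1 + ln u + real n * ln r"
    using ln_u ln_r n by (intro add_le_less_mono mult_strict_left_mono) auto
  also have "\<dots> = 1 + ln (u * r ^ n)"
    using u r0 by (simp add: ln_mult ln_realpow)
  finally have "- 1 < ln (u * r ^ n)" by simp
  then have "exp (- 1) < u * r ^ n"
    using u r0 by (metis exp_less_cancel_iff exp_ln mult_pos_pos zero_less_power)
  then show ?thesis by (simp add: u_def mult_ac)
qed

lemma exp_minus_one_less_half: "exp (- 1) < (1 / 2 :: real)"
proof -
  have "ln (2::real) \<le> 2 - 1" "ln (2::real) \<noteq> 2 - 1"
    using ln_eq_minus_one[of 2] ln_le_minus_one[of 2] by auto
  then have "ln (2::real) < 1" by linarith
  then have "2 < exp (1::real)" by (metis exp_less_cancel_iff exp_ln zero_less_numeral)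
  then show ?thesis by (simp add: exp_minus field_simps)
qed

lemma log_concave_exists_large_term:
  fixes c :: "nat \<Rightarrow> real"
  assumes nonneg: "\<And>n. c n \<ge> 0"
    and lc: "\<And>n. c n * c (n + 2) \<le> (c (n + 1))\<^sup>2"
    and no_gap: "\<And>m n. m \<le> n \<Longrightarrow> c n \<noteq> 0 \<Longrightarrow> c m \<noteq> 0"
    and c0: "c 0 > 0" and sums: "c sums 1"
  shows "\<exists>n. exp (- 1) < (real n + 1) * c n"
proof -
  obtain n where right: "real (n + 2) * c (n + 1) \<le> real (n + 1) * c n"
    and left: "n > 0 \<Longrightarrow> real n * c (n - 1) \<le> real (n + 1) * c n" and pos: "c n > 0"
    using summable_local_max[OF sums_summable[OF sums] c0] by blast
  \<comment> \<open>The first entry is what \<open>right\<close> of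
    \<open>log_concave_geometric_bound\<close> demands, the second is what
    \<open>geometric_weight_gt\<close> demands. Both entries are at most
    \<open>(n + 1) / (n + 2)\<close> and, for \<open>n > 0\<close>, at most
    \<open>c n / c (n - 1)\<close>, so their maximum meets the upper bounds too.\<close>
  define r where "r = max (c (n + 1) / c n) (real n / (real n + 1))"
  have lo: "real n / (real n + 1) \<le> r" by (simp add: r_def)
  have "c (n + 1) / c n \<le> (real n + 1) / (real n + 2)"
    using right pos by (simp add: field_simps)
  moreover have "real n / (real n + 1) \<le> (real n + 1) / (real n + 2)"
    by (simp add: field_simps)
  ultimately have hi: "r \<le> (real n + 1) / (real n + 2)" by (simp add: r_def)
  have r0: "r \<ge> 0" by (rule order_trans[OF _ lo]) simp
  have r1: "r < 1" using hi by (rule le_less_trans) simp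
  have bound: "c k * r ^ n \<le> c n * r ^ k" for k
  proof (rule log_concave_geometric_bound[OF nonneg lc no_gap pos r0])
    have "c (n + 1) / c n \<le> r" by (simp add: r_def)
    then show "c (n + 1) \<le> r * c n" using pos by (simp add: field_simps)
    show "r * c (n - 1) \<le> c n" if "n > 0"
    proof -
      have p: "c (n - 1) > 0" using no_gap[of "n - 1" n] pos nonneg by (simp add: less_le)
      have "c (n + 1) * c (n - 1) \<le> c n * c n"
        using lc[of "n - 1"] that by (simp add: power2_eq_square mult.commute)
      then have "c (n + 1) / c n \<le> c n / c (n - 1)"
        using p pos by (simp add: field_simps)
      moreover have "real n / (real n + 1) \<le> c n / c (n - 1)"
        using left that p by (simp add: field_simps)
      ultimately have "r \<le> c n / c (n - 1)" by (simp add: r_def)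
      then show ?thesis using p by (simp add: field_simps)
    qed
  qed auto
  have "(\<lambda>k. c k * r ^ n) sums (1 * r ^ n)"
    using sums by (rule sums_mult2)
  moreover have "(\<lambda>k. c n * r ^ k) sums (c n * (1 / (1 - r)))"
    using r0 r1 by (intro sums_mult geometric_sums) simp
  ultimately have "1 * r ^ n \<le> c n * (1 / (1 - r))"
    by (rule sums_le[OF bound])
  then have main: "r ^ n * (1 - r) \<le> c n"
    using r1 by (simp add: field_simps)
  have "exp (- 1) < (real n + 1) * c n"
  proof (cases "n = 0")
    case True
    \<comment> \<open>For \<open>n = 0\<close> the bound \<open>hi\<close> says
      \<open>r <= 1 / 2\<close>, and \<open>main\<close> becomes
      \<open>1 - r <= c 0\<close>.\<close>
    then have "1 / 2 \<le> c n" using main hi by simp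
    then show ?thesis using True exp_minus_one_less_half by simp
  next
    case False
    then have "exp (- 1) < (real n + 1) * r ^ n * (1 - r)"
      using geometric_weight_gt[OF _ lo hi] by simp
    also have "\<dots> \<le> (real n + 1) * c n"
      using main by (simp add: mult.assoc mult_left_mono)
    finally show ?thesis .
  qed
  then show ?thesis by blast
qed

subsection \<open>Monotone mass functions\<close>

lemma has_sum_pmf_1: "(pmf p has_sum 1) UNIV"
proof -
  have "infsum (pmf p) UNIV = 1"
    using infsetsum_pmf_eq_1[of p UNIV] infsetsum_infsum[OF pmf_abs_summable, of p UNIV] by simp
  \<comment> \<open>\<open>infsum\<close> is 0 by default when there is no sum, so the value 1
    forces summability.\<close>
  then show ?thesis by (metis has_sum_infsum infsum_not_exists zero_neq_one)
qed

text \<open>Reading the convolution as the probability of an antidiagonal bounds it by 1 and later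
  identifies it with the mass function of \<open>X + Y\<close>.\<close>

lemma conv_pmf: "conv (pmf p) (pmf q) k = measure (pair_pmf p q) {(x, y). x + y = k}"
proof -
  have "measure (pair_pmf p q) {(x, y). x + y = k} = infsum (pmf (pair_pmf p q)) {(x, y). x + y = k}"
    by (simp add: measure_pmf_conv_infsetsum infsetsum_infsum pmf_abs_summable)
  also have "\<dots> = infsum (pmf (pair_pmf p q)) (range (\<lambda>i. (i, k - i)))"
    by (rule arg_cong[where f = "infsum _"]) auto
  also have "\<dots> = (\<Sum>\<^sub>\<infinity>i. pmf (pair_pmf p q) (i, k - i))"
    by (subst infsum_reindex) (auto simp: inj_on_def o_def)
  finally show ?thesis by (simp add: conv_def pmf_pair)
qed

lemma bdd_above_conv_pmf: "bdd_above (range (conv (pmf p) (pmf q)))"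
  by (auto intro!: bdd_aboveI[of _ 1] simp: conv_pmf)

lemma bdd_above_pmf: "bdd_above (range (pmf p))"
  by (auto intro!: bdd_aboveI[of _ 1] simp: pmf_le_1)

lemma conv_supported_from:
  assumes "\<And>i. i < a \<Longrightarrow> f i = 0"
  shows "conv f f (2 * a + int n) = (\<Sum>i\<le>n. f (a + int i) * f (a + int (n - i)))"
proof -
  have "conv f f (2 * a + int n) = (\<Sum>\<^sub>\<infinity>i\<in>(\<lambda>i. a + int i) ` {..n}. f i * f (2 * a + int n - i))"
    unfolding conv_def
  proof (rule infsum_cong_neutral)
    fix i assume i: "i \<in> UNIV - (\<lambda>i. a + int i) ` {..n}"
    show "f i * f (2 * a + int n - i) = 0"
    proof (cases "i < a \<or> i > a + int n")
      case True
      \<comment> \<open>If \<open>i > a + n\<close>, it is the other argument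
        \<open>2 * a + n - i\<close> that lies below \<open>a\<close>.\<close>
      then show ?thesis using assms[of i] assms[of "2 * a + int n - i"] by auto
    next
      case False
      then have "i = a + int (nat (i - a))" "nat (i - a) \<le> n" by auto
      then show ?thesis using i by blast
    qed
  qed auto
  also have "\<dots> = (\<Sum>i\<le>n. f (a + int i) * f (2 * a + int n - (a + int i)))"
    by (subst infsum_reindex) (auto simp: inj_on_def)
  also have "\<dots> = (\<Sum>i\<le>n. f (a + int i) * f (a + int (n - i)))"
    by (intro sum.cong) (auto simp: of_nat_diff algebra_simps)
  finally show ?thesis .
qed

text \<open>If the support were unbounded below, contiguity would put every \<open>y <= x\<close>
  into it, and monotonicity would give \<open>f y >= f x > 0\<close> there, so the total mass would
  be infinite.\<close>

lemma antimono_summable_supp_has_least: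
  assumes nonneg: "\<And>k. f k \<ge> 0" and sum: "(f has_sum 1) UNIV"
    and ivl: "\<forall>i\<in>supp f. \<forall>k\<in>supp f. {i..k} \<subseteq> supp f"
    and anti: "antimono_on (supp f) f"
  obtains a where "a \<in> supp f" "\<And>i. i < a \<Longrightarrow> f i = 0"
proof -
  have "\<exists>x. x \<in> supp f"
  proof (rule ccontr)
    assume "\<nexists>x. x \<in> supp f"
    then have "f = (\<lambda>_. 0)" by (auto simp: supp_def)
    then show False using has_sum_unique[OF sum, of 0] by simp
  qed
  then obtain x where x: "x \<in> supp f" by blast
  have fx: "f x > 0" using x nonneg[of x] by (simp add: supp_def less_le)
  have "\<exists>b. \<forall>i\<in>supp f. b \<le> i"
  proof (rule ccontr)
    assume "\<nexists>b. \<forall>i\<in>supp f. b \<le> i"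
    then have unb: "\<exists>i\<in>supp f. i < b" for b by (meson not_le)
    have ge: "f x \<le> f y" if "y \<le> x" for y
    proof -
      obtain i where "i \<in> supp f" "i < y" using unb by blast
      then have "y \<in> supp f" using ivl x that by fastforce
      then show ?thesis using anti x that by (auto simp: monotone_on_def)
    qed
    define N where "N = nat \<lceil>1 / f x\<rceil> + 1"
    have "1 < real N * f x"
    proof -
      have "1 / f x < real N" unfolding N_def by linarith
      then show ?thesis using fx by (simp add: field_simps)
    qed
    also have "\<dots> = (\<Sum>i\<in>{x - int N<..x}. f x)" by simp
    also have "\<dots> \<le> sum f {x - int N<..x}"
      by (intro sum_mono ge) auto
    also have "\<dots> \<le> 1"
      by (rule finite_sum_le_has_sum[OF sum]) (auto simp: nonneg)
    finally show False by simp
  qed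
  then obtain b where b: "\<And>i. i \<in> supp f \<Longrightarrow> b \<le> i" by blast
  \<comment> \<open>Measuring from the lower bound \<open>b\<close> moves the search for a least
    element from the integers to the well-ordered naturals.\<close>
  define m where "m = (LEAST m. b + int m \<in> supp f)"
  have ex: "b + int (nat (x - b)) \<in> supp f" using x b[OF x] by simp
  show ?thesis
  proof
    show "b + int m \<in> supp f" unfolding m_def using ex by (rule LeastI)
    show "f i = 0" if "i < b + int m" for i
    proof (rule ccontr)
      assume "f i \<noteq> 0"
      then have i: "i \<in> supp f" by (simp add: supp_def)
      then have "b + int (nat (i - b)) \<in> supp f" using b[OF i] by simp
      then have "m \<le> nat (i - b)" unfolding m_def by (rule Least_le)
      then show False using that b[OF i] by linarith
    qed
  qed
qed

text \<open>The conclusion names a point \<open>k\<close>; passing to the supremum takes boundedness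
  of the convolution, which \<open>sup_norm_conv_pmf_gt\<close> supplies.\<close>

lemma exists_conv_gt_of_antimono:
  assumes nonneg: "\<And>k. f k \<ge> 0" and sum: "(f has_sum 1) UNIV"
    and lc: "log_concave f" and anti: "antimono_on (supp f) f"
  shows "\<exists>k. exp (- 1) * sup_norm f < conv f f k"
proof -
  have ivl: "\<forall>i\<in>supp f. \<forall>k\<in>supp f. {i..k} \<subseteq> supp f"
    using lc by (simp add: log_concave_def)
  obtain a where a: "a \<in> supp f" and below: "\<And>i. i < a \<Longrightarrow> f i = 0"
    using antimono_summable_supp_has_least[OF nonneg sum ivl anti] by blast
  define c where "c = (\<lambda>n. f (a + int n))"
  have c_nonneg: "c n \<ge> 0" for n by (simp add: c_def nonneg)
  have c0: "c 0 > 0" using a nonneg[of a] by (simp add: c_def supp_def less_le)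
  have c_lc: "c n * c (n + 2) \<le> (c (n + 1))\<^sup>2" for n
    using lc[unfolded log_concave_def, THEN conjunct1, rule_format, of "a + int n"]
    by (simp add: c_def add_ac)
  have no_gap: "c m \<noteq> 0" if "m \<le> n" "c n \<noteq> 0" for m n
  proof -
    have "a + int n \<in> supp f" using that by (simp add: c_def supp_def)
    then have "a + int m \<in> supp f" using ivl a that by fastforce
    then show ?thesis by (simp add: c_def supp_def)
  qed
  have "(f has_sum 1) UNIV \<longleftrightarrow> (f has_sum 1) (range (\<lambda>n. a + int n))"
  proof (rule has_sum_cong_neutral)
    fix i assume i: "i \<in> UNIV - range (\<lambda>n. a + int n)"
    show "f i = 0"
    proof (rule ccontr)
      assume "f i \<noteq> 0"
      then have "i = a + int (nat (i - a))" using below[of i] by fastforce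
      then show False using i by blast
    qed
  qed auto
  then have "(f has_sum 1) (range (\<lambda>n. a + int n))" using sum by simp
  then have "(c has_sum 1) UNIV"
    by (subst (asm) has_sum_reindex) (auto simp: inj_on_def c_def o_def)
  then have "c sums 1" by (rule has_sum_imp_sums)
  with c_nonneg c_lc no_gap c0 have "\<exists>n. exp (- 1) < (real n + 1) * c n"
    by (rule log_concave_exists_large_term)
  then obtain n where n: "exp (- 1) < (real n + 1) * c n" by blast
  \<comment> \<open>The first point of the support carries the largest mass, so \<open>c 0\<close>
    bounds the norm.\<close>
  have "f k \<le> f a" for k
  proof (cases "f k = 0")
    case False
    then have "k \<in> supp f" "a \<le> k" using below[of k] by (fastforce simp: supp_def)+
    then show ?thesis using anti a by (auto simp: monotone_on_def)
  qed (simp add: nonneg)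
  then have "sup_norm f \<le> c 0"
    unfolding sup_norm_def c_def by (intro cSUP_least) auto
  then have "exp (- 1) * sup_norm f \<le> exp (- 1) * c 0" by simp
  also have "\<dots> < (real n + 1) * c n * c 0" using n c0 by (intro mult_strict_right_mono)
  \<comment> \<open>All \<open>n + 1\<close> summands equal \<open>c 0 * c n\<close>; they are
    written in the shape that \<open>log_concave_split\<close> expects.\<close>
  also have "\<dots> = (\<Sum>i\<le>n. c 0 * c (i + (n - i)))" by (simp add: mult_ac)
  also have "\<dots> \<le> (\<Sum>i\<le>n. c i * c (n - i))"
    by (rule sum_mono, rule log_concave_split[OF c_nonneg c_lc]) (rule no_gap)
  also have "\<dots> = conv f f (2 * a + int n)"
    by (subst conv_supported_from) (auto simp: below c_def)
  finally show ?thesis by blast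
qed

lemma exists_conv_gt_of_monotone:
  assumes nonneg: "\<And>k. f k \<ge> 0" and sum: "(f has_sum 1) UNIV"
    and lc: "log_concave f" and mono: "monotone_mass f"
  shows "\<exists>k. exp (- 1) * sup_norm f < conv f f k"
proof (cases "antimono_on (supp f) f")
  case True
  then show ?thesis using assms by (intro exists_conv_gt_of_antimono)
next
  case False
  then have mono: "mono_on (supp f) f" using mono by (simp add: monotone_mass_def)
  \<comment> \<open>Reflection exchanges the two kinds of monotonicity, keeps the norm and reflects
    the convolution. The triple \<open>k, k + 1, k + 2\<close> is reversed, hence log-concavity of
    \<open>f\<close> is used at \<open>- k - 2\<close>.\<close>
  define g where "g = (\<lambda>k. f (- k))"
  have bij: "bij (uminus :: int \<Rightarrow> int)" by (rule bij_uminus)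
  have supp_g: "k \<in> supp g \<longleftrightarrow> - k \<in> supp f" for k by (simp add: supp_def g_def)
  have "(g has_sum 1) UNIV"
    unfolding g_def using has_sum_reindex_bij_betw[OF bij] sum by blast
  moreover have "log_concave g"
    unfolding log_concave_def
  proof (intro conjI allI ballI subsetI)
    fix k show "g k * g (k + 2) \<le> (g (k + 1))\<^sup>2"
      using lc[unfolded log_concave_def, THEN conjunct1, rule_format, of "- k - 2"]
      by (simp add: g_def algebra_simps)
  next
    fix i k j assume "i \<in> supp g" "k \<in> supp g" "j \<in> {i..k}"
    then have "- k \<in> supp f" "- i \<in> supp f" "- j \<in> {- k..- i}" by (auto simp: supp_g)
    then show "j \<in> supp g"
      using lc unfolding log_concave_def supp_g by blast
  qed
  moreover have "antimono_on (supp g) g"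
    unfolding monotone_on_def
  proof (intro ballI impI)
    fix x y assume "x \<in> supp g" "y \<in> supp g" "x \<le> y"
    then show "g y \<le> g x"
      using monotone_onD[OF mono, of "- y" "- x"] unfolding supp_g by (simp add: g_def)
  qed
  ultimately obtain k where k: "exp (- 1) * sup_norm g < conv g g k"
    using exists_conv_gt_of_antimono[of g] nonneg by (auto simp: g_def)
  have "range g = range f"
    unfolding g_def using bij_is_surj[OF bij] by (metis image_image)
  then have "sup_norm g = sup_norm f" by (simp add: sup_norm_def)
  moreover have "conv g g k = conv f f (- k)"
    unfolding conv_def g_def
    using infsum_reindex_bij_betw[OF bij, of "\<lambda>i. f i * f (- k - i)"] by simp
  ultimately show ?thesis using k by auto
qed

lemma sup_norm_conv_pmf_gt:
  assumes "log_concave (pmf p)" "monotone_mass (pmf p)"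
  shows "exp (- 1) * sup_norm (pmf p) < sup_norm (conv (pmf p) (pmf p))"
proof -
  obtain k where "exp (- 1) * sup_norm (pmf p) < conv (pmf p) (pmf p) k"
    using exists_conv_gt_of_monotone[OF pmf_nonneg has_sum_pmf_1 assms] by blast
  also have "\<dots> \<le> sup_norm (conv (pmf p) (pmf p))"
    unfolding sup_norm_def by (rule cSUP_upper[OF UNIV_I bdd_above_conv_pmf])
  finally show ?thesis .
qed

lemma sup_norm_pmf_pos: "sup_norm (pmf p) > 0"
proof -
  obtain x where "x \<in> set_pmf p" using set_pmf_not_empty[of p] by blast
  then have "0 < pmf p x" by (simp add: pmf_positive)
  also have "\<dots> \<le> sup_norm (pmf p)"
    unfolding sup_norm_def by (rule cSUP_upper[OF UNIV_I bdd_above_pmf])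
  finally show ?thesis .
qed

subsection \<open>Random variables\<close>

lemma (in prob_space) countable_distr_is_pmf:
  fixes Z :: "'a \<Rightarrow> 'b :: countable"
  assumes Z: "Z \<in> M \<rightarrow>\<^sub>M count_space UNIV"
  obtains p where "\<And>A. measure (measure_pmf p) A = prob {\<omega> \<in> space M. Z \<omega> \<in> A}"
proof -
  let ?D = "distr M (count_space UNIV) Z"
  interpret D: prob_space ?D using Z by (rule prob_space_distr)
  \<comment> \<open>This is the condition in the type \<open>pmf\<close> that needs an argument:
    almost every point is an atom, since the target is countable.\<close>
  have "AE x in ?D. measure ?D {x} \<noteq> 0"
    by (subst D.AE_support_countable) (auto intro!: exI[of _ UNIV])
  then obtain p where p: "measure_pmf p = ?D"
    using type_definition.Abs_inverse[OF type_definition_pmf, of ?D] D.prob_space_axioms by auto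
  have "measure (measure_pmf p) A = prob {\<omega> \<in> space M. Z \<omega> \<in> A}" for A
    unfolding p using Z by (subst measure_distr) (auto intro!: arg_cong[of _ _ prob])
  then show ?thesis using that by blast
qed

lemma iid_obtain_pmf:
  assumes "prob_space M" and "iid M X Y"
  obtains p where "mass_fun M X = pmf p"
    and "mass_fun M (\<lambda>\<omega>. X \<omega> + Y \<omega>) = conv (pmf p) (pmf p)"
proof -
  interpret prob_space M by fact
  have indep: "indep_var (count_space UNIV) X (count_space UNIV) Y"
    and eq: "distr M (count_space UNIV) X = distr M (count_space UNIV) Y"
    using assms by (auto simp: iid_def)
  have X: "X \<in> M \<rightarrow>\<^sub>M count_space UNIV" and Y: "Y \<in> M \<rightarrow>\<^sub>M count_space UNIV"
    using indep_var_rv1[OF indep] indep_var_rv2[OF indep] by auto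
  have XY: "(\<lambda>\<omega>. (X \<omega>, Y \<omega>)) \<in> M \<rightarrow>\<^sub>M count_space UNIV"
    using X Y by measurable
  obtain p where p: "\<And>A. measure (measure_pmf p) A = prob {\<omega> \<in> space M. X \<omega> \<in> A}"
    using countable_distr_is_pmf[OF X] by blast
  obtain q where q: "\<And>A. measure (measure_pmf q) A = prob {\<omega> \<in> space M. (X \<omega>, Y \<omega>) \<in> A}"
    using countable_distr_is_pmf[OF XY] by blast
  have pX: "pmf p i = prob {\<omega> \<in> space M. X \<omega> = i}" for i
    using p[of "{i}"] by (simp add: pmf.rep_eq)
  have pY: "pmf p i = prob {\<omega> \<in> space M. Y \<omega> = i}" for i
  proof -
    have "prob (X -` {i} \<inter> space M) = prob (Y -` {i} \<inter> space M)"
      using arg_cong[OF eq, of "\<lambda>D. measure D {i}"] X Y by (simp add: measure_distr)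
    then show ?thesis by (simp add: pX vimage_def Collect_conj_eq Int_commute)
  qed
  \<comment> \<open>Independence is used only on singletons: the joint law is discrete, so it is
    determined by its atoms.\<close>
  have "q = pair_pmf p p"
  proof (rule pmf_eqI, clarify)
    fix i j
    have "pmf q (i, j) = prob {\<omega> \<in> space M. X \<omega> = i \<and> Y \<omega> = j}"
      using q[of "{(i, j)}"] by (simp add: pmf.rep_eq)
    also have "\<dots> = prob ((\<lambda>\<omega>. (X \<omega>, Y \<omega>)) -` ({i} \<times> {j}) \<inter> space M)"
      by (rule arg_cong[of _ _ prob]) auto
    also have "\<dots> = prob (X -` {i} \<inter> space M) * prob (Y -` {j} \<inter> space M)"
      by (rule indep_varD[OF indep]) auto
    also have "\<dots> = pmf p i * pmf p j"
      unfolding pX[of i] pY[of j] by (simp add: vimage_def Collect_conj_eq Int_commute)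
    finally show "pmf q (i, j) = pmf (pair_pmf p p) (i, j)" by (simp add: pmf_pair)
  qed
  show ?thesis
  proof
    show "mass_fun M X = pmf p" by (simp add: fun_eq_iff mass_fun_def pX)
    show "mass_fun M (\<lambda>\<omega>. X \<omega> + Y \<omega>) = conv (pmf p) (pmf p)"
      using q \<open>q = pair_pmf p p\<close> by (simp add: fun_eq_iff mass_fun_def conv_pmf)
  qed
qed

subsection \<open>Optimality\<close>

text \<open>Two uses of \<open>1 + t <= exp t\<close>: one gives \<open>q ^ n <= exp (- x)\<close>
  for \<open>x = n * (1 - q)\<close>, the other shows that \<open>x * exp (- x)\<close> is largest
  at \<open>x = 1\<close>.\<close>

lemma times_power_le_exp_minus_one:
  fixes q :: real
  assumes "0 < q" "q < 1"
  shows "real n * (1 - q) * q ^ n \<le> exp (- 1)"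
proof -
  have "q \<le> exp (- (1 - q))" using exp_ge_add_one_self[of "- (1 - q)"] by simp
  then have "q ^ n \<le> exp (- (1 - q)) ^ n" using assms by (intro power_mono) auto
  also have "\<dots> = exp (- (real n * (1 - q)))" by (simp add: algebra_simps flip: exp_of_nat_mult)
  finally have 1: "q ^ n \<le> exp (- (real n * (1 - q)))" .
  define x where "x = real n * (1 - q)"
  have x: "x \<ge> 0" using assms by (simp add: x_def)
  have "x \<le> exp (x - 1)" using exp_ge_add_one_self[of "x - 1"] by simp
  then have "x * exp (- x) \<le> exp (x - 1) * exp (- x)" by (rule mult_right_mono) simp
  also have "\<dots> = exp (- 1)" by (simp flip: exp_add)
  finally have "x * exp (- x) \<le> exp (- 1)" .
  moreover have "x * q ^ n \<le> x * exp (- x)" using 1 x by (intro mult_left_mono) (auto simp: x_def)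
  ultimately show ?thesis by (simp add: x_def)
qed

lemma geometric_counterexample:
  fixes c :: real
  assumes c: "c > exp (- 1)"
  shows "\<exists>p :: int pmf. log_concave (pmf p) \<and> monotone_mass (pmf p) \<and>
           sup_norm (conv (pmf p) (pmf p)) \<le> c * sup_norm (pmf p)"
proof -
  have c0: "c > 0" using c exp_gt_zero[of "- 1 :: real"] by linarith
  \<comment> \<open>The convolution of the geometric law turns out to be at most
    \<open>exp (- 1) * (1 - q) / q\<close>, while its norm is at least \<open>1 - q\<close>; this
    \<open>q\<close> makes the quotient of the two bounds equal to \<open>c\<close>, and
    \<open>c > exp (- 1)\<close> gives \<open>q < 1\<close>.\<close>
  define q where "q = exp (- 1) / c"
  have q: "0 < q" "q < 1" using c c0 by (auto simp: q_def)
  define p where "p = map_pmf int (geometric_pmf (1 - q))"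
  have pn: "pmf p (int n) = q ^ n * (1 - q)" for n
    using q pmf_map_inj'[of int "geometric_pmf (1 - q)" n] by (simp add: p_def inj_def)
  have neg: "pmf p k = 0" if "k < 0" for k
    using that by (auto simp: pmf_eq_0_set_pmf p_def)
  have pk: "pmf p k = (if k < 0 then 0 else q ^ nat k * (1 - q))" for k
    using pn[of "nat k"] neg[of k] by auto
  have supp: "supp (pmf p) = {0..}" using q by (auto simp: supp_def pk)
  have "log_concave (pmf p)"
    unfolding log_concave_def supp
  proof (intro conjI allI)
    fix k
    show "pmf p k * pmf p (k + 2) \<le> (pmf p (k + 1))\<^sup>2"
    proof (cases "k < 0")
      case False
      then obtain n where n: "k = int n" by (metis nat_0_le not_less)
      have e: "pmf p (k + 1) = q ^ (n + 1) * (1 - q)" "pmf p (k + 2) = q ^ (n + 2) * (1 - q)"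
        using pn[of "n + 1"] pn[of "n + 2"] by (simp_all add: n add_ac)
      show ?thesis unfolding e unfolding n pn by (simp add: power2_eq_square algebra_simps)
    qed (simp add: neg)
  qed auto
  moreover have "monotone_mass (pmf p)"
    unfolding monotone_mass_def supp using q
    by (intro disjI1) (auto simp: monotone_on_def pk intro!: mult_right_mono power_decreasing nat_mono)
  moreover have "sup_norm (conv (pmf p) (pmf p)) \<le> c * sup_norm (pmf p)"
  proof -
    have "1 - q \<le> sup_norm (pmf p)"
      using cSUP_upper[OF UNIV_I bdd_above_pmf, of p 0] pn[of 0] by (simp add: sup_norm_def)
    then have "c * (1 - q) \<le> c * sup_norm (pmf p)" using c0 by simp
    moreover have "conv (pmf p) (pmf p) k \<le> c * (1 - q)" for k
    proof (cases "k < 0")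
      case True
      then have z: "pmf p i * pmf p (k - i) = 0" for i
        using neg[of i] neg[of "k - i"] by (cases "i < 0") auto
      show ?thesis unfolding conv_def z using c0 q by simp
    next
      case False
      then obtain n where n: "k = int n" by (metis nat_0_le not_less)
      have "conv (pmf p) (pmf p) k = (\<Sum>i\<le>n. pmf p (int i) * pmf p (int (n - i)))"
        using conv_supported_from[of 0 "pmf p" n] neg by (simp add: n)
      also have "\<dots> = (\<Sum>i\<le>n. (1 - q)\<^sup>2 * q ^ n)"
      proof (intro sum.cong refl)
        fix i assume "i \<in> {..n}"
        then have "q ^ n = q ^ i * q ^ (n - i)" by (simp flip: power_add)
        then show "pmf p (int i) * pmf p (int (n - i)) = (1 - q)\<^sup>2 * q ^ n"
          unfolding pn by (simp add: power2_eq_square mult_ac)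
      qed
      \<comment> \<open>One more factor \<open>q\<close> is borrowed so that the exponent matches
        the number \<open>n + 1\<close> of summands, as \<open>times_power_le_exp_minus_one\<close>
        requires.\<close>
      also have "\<dots> = (real (n + 1) * (1 - q) * q ^ (n + 1)) * ((1 - q) / q)"
        using q by (simp add: power2_eq_square)
      also have "\<dots> \<le> exp (- 1) * ((1 - q) / q)"
        using q by (intro mult_right_mono times_power_le_exp_minus_one) auto
      also have "\<dots> = c * (1 - q)" using c0 by (simp add: q_def)
      finally show ?thesis .
    qed
    then have "sup_norm (conv (pmf p) (pmf p)) \<le> c * (1 - q)"
      unfolding sup_norm_def by (intro cSUP_least) auto
    ultimately show ?thesis by linarith
  qed
  ultimately show ?thesis by blast
qed

theorem theorem4p3:
  "(\<forall>(M :: 'a measure) (X :: 'a \<Rightarrow> int) (Y :: 'a \<Rightarrow> int) (f :: int \<Rightarrow> real).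
      prob_space M \<and> iid M X Y \<and> f = mass_fun M X \<and> log_concave f \<and> monotone_mass f \<longrightarrow>
        sup_norm (conv f f) > exp (- 1) * sup_norm f \<and>
        H_inf M (\<lambda>\<omega>. X \<omega> + Y \<omega>) < H_inf M X + 1) \<and>
   (\<forall>c :: real. c > exp (- 1) \<longrightarrow>
      \<not> (\<forall>p :: int pmf. log_concave (pmf p) \<and> monotone_mass (pmf p) \<longrightarrow>
            sup_norm (conv (pmf p) (pmf p)) > c * sup_norm (pmf p)))"
proof (intro conjI allI impI)
  fix M :: "'a measure" and X Y :: "'a \<Rightarrow> int" and f :: "int \<Rightarrow> real"
  assume *: "prob_space M \<and> iid M X Y \<and> f = mass_fun M X \<and> log_concave f \<and> monotone_mass f"
  then obtain p where p: "mass_fun M X = pmf p"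
    and XY: "mass_fun M (\<lambda>\<omega>. X \<omega> + Y \<omega>) = conv (pmf p) (pmf p)"
    using iid_obtain_pmf[of M X Y] by blast
  have f: "f = pmf p" using * p by simp
  have gt: "exp (- 1) * sup_norm (pmf p) < sup_norm (conv (pmf p) (pmf p))"
    using * f by (intro sup_norm_conv_pmf_gt) auto
  then show "exp (- 1) * sup_norm f < sup_norm (conv f f)" by (simp add: f)
  have pos: "0 < exp (- 1) * sup_norm (pmf p)" using sup_norm_pmf_pos by simp
  have "ln (exp (- 1) * sup_norm (pmf p)) < ln (sup_norm (conv (pmf p) (pmf p)))"
    using gt pos by (subst ln_less_cancel_iff) auto
  then show "H_inf M (\<lambda>\<omega>. X \<omega> + Y \<omega>) < H_inf M X + 1"
    using sup_norm_pmf_pos[of p] by (simp add: H_inf_def p XY ln_mult)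
next
  fix c :: real
  assume "exp (- 1) < c"
  then show "\<not> (\<forall>p :: int pmf. log_concave (pmf p) \<and> monotone_mass (pmf p) \<longrightarrow>
      c * sup_norm (pmf p) < sup_norm (conv (pmf p) (pmf p)))"
    using geometric_counterexample[of c] by (meson not_le)
qed

end
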